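(* If the WSBDF2 kernels $b^{(n)}_{n-k}$ are positive semi-definite, then the discrete solution $u^n$ of the WSBDF2 method is unconditionally stable in the $L^2$ norm: $$\|u^n\|\le\|u^0\|+2\sum_{k=1}^n\sum_{j=1}^k d_{k-j}^{(k)}\,\|\theta f^j+(1-\theta)f^{j-1}\|\le\|u^0\|+2t_n\max_{1\le j\le n}\|f^j\|\qquad\text{for } n\ge1 .$$ Thus, the WSBDF2 method is monotonicity-preserving.
   Context: Let $\theta\in[1/2,1]$. Let $(\cdot,\cdot)$ and $\|\cdot\|$ be the inner product and norm of $L^2(\Omega)$, where $\Omega$ is a domain for which there is a constant $C_\Omega>0$ with $\|\phi\|\le C_\Omega\|\nabla\phi\|$ for all $\phi\in H_0^1(\Omega)$. Let $0=t_0<t_1<\cdots<t_N=T$ be a nonuniform time grid with steps $\tau_k=t_k-t_{k-1}$ ($1\le k\le N$) and ratios $r_k=\tau_k/\tau_{k-1}$ ($2\le k\le N$); time indices $n$ run up to $N$. Write $\nabla_\tau v^n=v^n-v^{n-1}$. The WSBDF2 (weighted and shifted BDF2) discrete convolution kernels are $b_0^{(1)}=1/\tau_1$ and, for $n\ge2$, $$b_0^{(n)}=\frac{1+2\theta r_n}{\tau_n(1+r_n)},\qquad b_1^{(n)}=\frac{(1-2\theta)r_n^2}{\tau_n(1+r_n)},\qquad b_j^{(n)}=0\ \ (2\le j\le n-1),$$ and the WSBDF2 operator is $D_2v^n=\sum_{k=1}^n b_{n-k}^{(n)}\nabla_\tau v^k$, $n\ge1$ (so $D_2v^1=\nabla_\tau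 v^1/\tau_1$). The kernels are called positive semi-definite if $\sum_{k=1}^n w_k\sum_{j=1}^k b_{k-j}^{(k)}w_j\ge0$ for every $n\ge1$ and every real sequence $\{w_k\}_{k=1}^n$. The discrete orthogonal convolution (DOC) kernels are defined by $$d_0^{(n)}=\frac1{b_0^{(n)}},\qquad d_{n-k}^{(n)}=-\frac1{b_0^{(k)}}\sum_{j=k+1}^n d_{n-j}^{(n)}b_{j-k}^{(j)}=-\frac{b_1^{(k+1)}}{b_0^{(k)}}d_{n-k-1}^{(n)}\quad(1\le k\le n-1).$$ Given the initial value $u^0$ and $f^n=f(t_n)$, the WSBDF2 method for $u'-\Delta u=f$ defines $u^n$ recursively by $$D_2u^n-\theta\Delta u^n-(1-\theta)\Delta u^{n-1}=\theta f^n+(1-\theta)f^{n-1},\qquad n\ge1,$$ understood weakly, tested against all $\phi\in H_0^1(\Omega)$ with $u^n\in H_0^1(\Omega)$ (homogeneous Dirichlet boundary conditions). The term "monotonicity-preserving" is used without a formal definition; it is asserted as a consequence of the displayed bound.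
   Formalization: The last bound as printed fails for θ<1 (n=1, u^0=0, f^1=0, f^0≠0); it is proved with the max over 0≤j≤n, and with the max over 1≤j≤n if θ=1 or ‖f^0‖≤max_{1≤j≤n}‖f^j‖. The undefined closing remark on monotonicity preservation is not formalized. *)

theory Defs
  imports "HOL-Analysis.Analysis"
begin

section \<open>Lebesgue and Sobolev spaces\<close>

text \<open>Elements of \<open>L\<^sup>2\<close> are represented by functions, not by classes modulo null sets; the
  codomain is a Euclidean space so that gradients are covered as well.\<close>

definition L2 :: "'a::euclidean_space set \<Rightarrow> ('a \<Rightarrow> 'b::euclidean_space) set" where
  "L2 \<Omega> = {u \<in> borel_measurable (lebesgue_on \<Omega>). integrable (lebesgue_on \<Omega>) (\<lambda>x. (norm (u x))\<^sup>2)}"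

definition l2_inner ::
    "'a::euclidean_space set \<Rightarrow> ('a \<Rightarrow> 'b::euclidean_space) \<Rightarrow> ('a \<Rightarrow> 'b) \<Rightarrow> real" where
  "l2_inner \<Omega> u v = (\<integral>x. u x \<bullet> v x \<partial>lebesgue_on \<Omega>)"

definition l2_norm :: "'a::euclidean_space set \<Rightarrow> ('a \<Rightarrow> 'b::euclidean_space) \<Rightarrow> real" where
  "l2_norm \<Omega> u = sqrt (l2_inner \<Omega> u u)"

definition partial_deriv ::
    "'a::euclidean_space \<Rightarrow> ('a \<Rightarrow> real) \<Rightarrow> 'a \<Rightarrow> real" where
  "partial_deriv b f x = frechet_derivative f (at x) b"

definition grad :: "('a::euclidean_space \<Rightarrow> real) \<Rightarrow> 'a \<Rightarrow> 'a" where
  "grad f x = (\<Sum>b\<in>Basis. partial_deriv b f x *\<^sub>R b)"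

text \<open>Smoothness is total differentiability of every iterated partial derivative, including the
  empty iteration; this makes all of them continuous.\<close>

definition smooth :: "('a::euclidean_space \<Rightarrow> real) \<Rightarrow> bool" where
  "smooth f \<longleftrightarrow> (\<forall>bs. set bs \<subseteq> Basis \<longrightarrow> fold partial_deriv bs f differentiable_on UNIV)"

definition test_functions :: "'a::euclidean_space set \<Rightarrow> ('a \<Rightarrow> real) set" where
  "test_functions \<Omega> =
     {\<psi>. smooth \<psi> \<and> compact (closure {x. \<psi> x \<noteq> 0}) \<and> closure {x. \<psi> x \<noteq> 0} \<subseteq> \<Omega>}"

text \<open>\<open>u\<close> belongs to \<open>H\<^sup>1(\<Omega>)\<close> and \<open>g\<close> is (a representative of) its distributional gradient.\<close>

definition H1_gradient ::
    "'a::euclidean_space set \<Rightarrow> ('a \<Rightarrow> real) \<Rightarrow> ('a \<Rightarrow> 'a) \<Rightarrow> bool" where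
  "H1_gradient \<Omega> u g \<longleftrightarrow> u \<in> L2 \<Omega> \<and> g \<in> L2 \<Omega> \<and>
     (\<forall>\<psi>\<in>test_functions \<Omega>. \<forall>b\<in>Basis.
        (\<integral>x. u x * partial_deriv b \<psi> x \<partial>lebesgue_on \<Omega>) =
        - (\<integral>x. (g x \<bullet> b) * \<psi> x \<partial>lebesgue_on \<Omega>))"

text \<open>\<open>u\<close> belongs to \<open>H\<^sub>0\<^sup>1(\<Omega>)\<close>, the closure of the test functions in the norm of \<open>H\<^sup>1(\<Omega>)\<close>, and
  \<open>g\<close> is its gradient. The gradient is carried along as a relation because it is only
  determined up to a null set.\<close>

definition H01_gradient ::
    "'a::euclidean_space set \<Rightarrow> ('a \<Rightarrow> real) \<Rightarrow> ('a \<Rightarrow> 'a) \<Rightarrow> bool" where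
  "H01_gradient \<Omega> u g \<longleftrightarrow> H1_gradient \<Omega> u g \<and>
     (\<exists>\<psi> :: nat \<Rightarrow> 'a \<Rightarrow> real. (\<forall>m. \<psi> m \<in> test_functions \<Omega>) \<and>
        (\<lambda>m. l2_norm \<Omega> (\<lambda>x. \<psi> m x - u x)) \<longlonglongrightarrow> 0 \<and>
        (\<lambda>m. l2_norm \<Omega> (\<lambda>x. grad (\<psi> m) x - g x)) \<longlonglongrightarrow> 0)"

definition poincare_domain :: "'a::euclidean_space set \<Rightarrow> bool" where
  "poincare_domain \<Omega> \<longleftrightarrow> open \<Omega> \<and> connected \<Omega> \<and> \<Omega> \<noteq> {} \<and>
     (\<exists>C>0. \<forall>\<phi> D\<phi>. H01_gradient \<Omega> \<phi> D\<phi> \<longrightarrow> l2_norm \<Omega> \<phi> \<le> C * l2_norm \<Omega> D\<phi>)"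

section \<open>Time grid and convolution kernels\<close>

definition time_grid :: "(nat \<Rightarrow> real) \<Rightarrow> nat \<Rightarrow> bool" where
  "time_grid t N \<longleftrightarrow> t 0 = 0 \<and> (\<forall>k\<in>{1..N}. t (k - 1) < t k)"

definition step :: "(nat \<Rightarrow> real) \<Rightarrow> nat \<Rightarrow> real" where
  "step t k = t k - t (k - 1)"

definition step_ratio :: "(nat \<Rightarrow> real) \<Rightarrow> nat \<Rightarrow> real" where
  "step_ratio t k = step t k / step t (k - 1)"

text \<open>Kernels are functions of the time level and the offset: \<open>b n j\<close> stands for
  \<open>b\<^sub>j\<^sup>(\<^sup>n\<^sup>)\<close>, and only \<open>1 \<le> n\<close>, \<open>j < n\<close> is meaningful.\<close>

definition wsbdf2_kernel :: "real \<Rightarrow> (nat \<Rightarrow> real) \<Rightarrow> nat \<Rightarrow> nat \<Rightarrow> real" where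
  "wsbdf2_kernel \<theta> t n j =
     (if n = 1 then (if j = 0 then 1 / step t 1 else 0)
      else if j = 0 then (1 + 2 * \<theta> * step_ratio t n) / (step t n * (1 + step_ratio t n))
      else if j = 1 then (1 - 2 * \<theta>) * (step_ratio t n)\<^sup>2 / (step t n * (1 + step_ratio t n))
      else 0)"

definition positive_semidefinite_kernel :: "nat \<Rightarrow> (nat \<Rightarrow> nat \<Rightarrow> real) \<Rightarrow> bool" where
  "positive_semidefinite_kernel N b \<longleftrightarrow>
     (\<forall>n\<in>{1..N}. \<forall>w :: nat \<Rightarrow> real. 0 \<le> (\<Sum>k=1..n. w k * (\<Sum>j=1..k. b k (k - j) * w j)))"

text \<open>The defining recursion is stated for the offset \<open>m = n - k\<close>; see \<open>doc_kernel_rec\<close>.\<close>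

function doc_kernel :: "(nat \<Rightarrow> nat \<Rightarrow> real) \<Rightarrow> nat \<Rightarrow> nat \<Rightarrow> real" where
  "doc_kernel b n m =
     (if m = 0 then 1 / b n 0
      else - (1 / b (n - m) 0) *
           (\<Sum>j\<in>{n - m + 1..n}. doc_kernel b n (n - j) * b j (j - (n - m))))"
  by auto
termination by (relation "Wellfounded.measure (\<lambda>(b, n, m). m)") auto

declare doc_kernel.simps [simp del]

lemma doc_kernel_0: "doc_kernel b n 0 = 1 / b n 0"
  by (simp add: doc_kernel.simps)

lemma doc_kernel_rec:
  assumes "1 \<le> k" "k \<le> n - 1"
  shows "doc_kernel b n (n - k) =
    - (1 / b k 0) * (\<Sum>j=k+1..n. doc_kernel b n (n - j) * b j (j - k))"
  using assms by (subst doc_kernel.simps) auto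

lemma doc_kernel_wsbdf2_rec:
  fixes \<theta> :: real and t :: "nat \<Rightarrow> real"
  assumes "1 \<le> k" "k \<le> n - 1"
  defines "b \<equiv> wsbdf2_kernel \<theta> t"
  shows "doc_kernel b n (n - k) = - (b (k + 1) 1 / b k 0) * doc_kernel b n (n - k - 1)"
proof -
  have "(\<Sum>j=k+1..n. doc_kernel b n (n - j) * b j (j - k)) =
        (\<Sum>j\<in>{k+1}. doc_kernel b n (n - j) * b j (j - k))"
    using assms(1,2) by (intro sum.mono_neutral_right) (auto simp: b_def wsbdf2_kernel_def)
  then show ?thesis
    using doc_kernel_rec[OF assms(1,2), of b] by simp
qed

section \<open>The WSBDF2 method\<close>

definition wsbdf2_op ::
    "real \<Rightarrow> (nat \<Rightarrow> real) \<Rightarrow> (nat \<Rightarrow> 'a \<Rightarrow> real) \<Rightarrow> nat \<Rightarrow> 'a \<Rightarrow> real" where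
  "wsbdf2_op \<theta> t v n x = (\<Sum>k=1..n. wsbdf2_kernel \<theta> t n (n - k) * (v k x - v (k - 1) x))"

definition weighted :: "real \<Rightarrow> (nat \<Rightarrow> 'a \<Rightarrow> 'b::real_vector) \<Rightarrow> nat \<Rightarrow> 'a \<Rightarrow> 'b" where
  "weighted \<theta> v n x = \<theta> *\<^sub>R v n x + (1 - \<theta>) *\<^sub>R v (n - 1) x"

definition wsbdf2_solution ::
    "'a::euclidean_space set \<Rightarrow> real \<Rightarrow> (nat \<Rightarrow> real) \<Rightarrow> nat \<Rightarrow> (real \<Rightarrow> 'a \<Rightarrow> real) \<Rightarrow>
     (nat \<Rightarrow> 'a \<Rightarrow> real) \<Rightarrow> bool" where
  "wsbdf2_solution \<Omega> \<theta> t N f u \<longleftrightarrow>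
     (\<exists>Du :: nat \<Rightarrow> 'a \<Rightarrow> 'a.
        (\<forall>n\<in>{0..N}. H01_gradient \<Omega> (u n) (Du n)) \<and>
        (\<forall>n\<in>{1..N}. \<forall>\<phi> D\<phi>. H01_gradient \<Omega> \<phi> D\<phi> \<longrightarrow>
           l2_inner \<Omega> (wsbdf2_op \<theta> t u n) \<phi> + l2_inner \<Omega> (weighted \<theta> Du n) D\<phi> =
           l2_inner \<Omega> (weighted \<theta> (\<lambda>j. f (t j)) n) \<phi>))"

end

theory Submission
  imports Defs
begin

text \<open>Write \<open>F\<^sup>j\<close> and \<open>U\<^sup>j\<close> for the weighted averages \<open>\<theta> f\<^sup>j + (1 - \<theta>) f\<^sup>j\<^sup>-\<^sup>1\<close> and
  \<open>\<theta> u\<^sup>j + (1 - \<theta>) u\<^sup>j\<^sup>-\<^sup>1\<close>. The DOC kernels \<open>d\<close> invert the convolution with \<open>b\<close>, so convolving the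
  scheme with them turns the multistep difference operator into a plain backward difference:
  \<open>u\<^sup>k - u\<^sup>k\<^sup>-\<^sup>1 - (\<Sum>j\<le>k. d \<Delta>U\<^sup>j) = (\<Sum>j\<le>k. d F\<^sup>j)\<close>. Testing this with \<open>U\<^sup>k\<close> and summing over \<open>k \<le> n\<close>
  yields an energy inequality, for two reasons.

  First, \<open>2 (u\<^sup>k - u\<^sup>k\<^sup>-\<^sup>1, U\<^sup>k)\<close> equals the increment of \<open>\<parallel>u\<^sup>k\<parallel>\<^sup>2\<close> plus \<open>(2 \<theta> - 1) \<parallel>u\<^sup>k - u\<^sup>k\<^sup>-\<^sup>1\<parallel>\<^sup>2\<close>, and
  the last term is nonnegative because \<open>\<theta> \<ge> 1/2\<close> (\<open>l2_inner_diff_weighted_ge\<close>). Second, the gradient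
  term is a quadratic form in the DOC kernels; it is nonnegative because the quadratic form of an
  inverse matrix at \<open>v = B w\<close> is the quadratic form of \<open>B\<close> at \<open>w\<close>
  (\<open>doc_kernel_positive_semidefinite\<close>), and a semidefinite kernel stays semidefinite on vector-valued
  \<open>L\<^sup>2\<close> functions (\<open>positive_semidefinite_kernel_l2\<close>). This gives \<open>wsbdf2_energy\<close>.

  To pass from squares to norms (\<open>wsbdf2_stability\<close>), the energy inequality is applied at the level
  \<open>m \<le> n\<close> where \<open>\<parallel>u\<^sup>m\<parallel>\<close> is largest. Every \<open>\<parallel>U\<^sup>k\<parallel>\<close> on the right is then at most \<open>\<parallel>u\<^sup>m\<parallel>\<close>, which cancels;
  here and when the sum is extended from \<open>m\<close> to \<open>n\<close> the DOC kernels have to be nonnegative, which is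
  again a consequence of \<open>\<theta> \<ge> 1/2\<close>. Finally, the operator is exact on the function \<open>t\<close>, so
  row \<open>k\<close> of the DOC kernels sums to the step \<open>\<tau>\<^sub>k\<close>, and a bound on all \<open>\<parallel>F\<^sup>j\<parallel>\<close> is multiplied by \<open>t\<^sub>n\<close>
  (\<open>wsbdf2_source_bound\<close>).\<close>

section \<open>The semi-inner product of square integrable functions\<close>

lemma l2_borel: "u \<in> L2 \<Omega> \<Longrightarrow> u \<in> borel_measurable (lebesgue_on \<Omega>)"
  by (simp add: L2_def)

text \<open>The pointwise Cauchy--Schwarz and arithmetic-geometric inequalities dominate the product by
  integrable squares.\<close>

lemma integrable_l2_inner:
  assumes "u \<in> L2 \<Omega>" "v \<in> L2 \<Omega>"
  shows "integrable (lebesgue_on \<Omega>) (\<lambda>x. u x \<bullet> v x)"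
proof (rule Bochner_Integration.integrable_bound)
  show "integrable (lebesgue_on \<Omega>) (\<lambda>x. (norm (u x))\<^sup>2 + (norm (v x))\<^sup>2)"
    using assms by (auto simp: L2_def)
  show "(\<lambda>x. u x \<bullet> v x) \<in> borel_measurable (lebesgue_on \<Omega>)"
    using assms[THEN l2_borel] by measurable
  show "AE x in lebesgue_on \<Omega>. norm (u x \<bullet> v x) \<le> norm ((norm (u x))\<^sup>2 + (norm (v x))\<^sup>2)"
  proof (rule AE_I2)
    fix x
    have "\<bar>u x \<bullet> v x\<bar> \<le> norm (u x) * norm (v x)"
      by (rule Cauchy_Schwarz_ineq2)
    also have "\<dots> \<le> (norm (u x))\<^sup>2 + (norm (v x))\<^sup>2"
      using sum_squares_bound[of "norm (u x)" "norm (v x)"]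
        mult_nonneg_nonneg[OF norm_ge_zero[of "u x"] norm_ge_zero[of "v x"]] by linarith
    finally show "norm (u x \<bullet> v x) \<le> norm ((norm (u x))\<^sup>2 + (norm (v x))\<^sup>2)"
      by simp
  qed
qed

lemma l2_lincomb:
  assumes "u \<in> L2 \<Omega>" "v \<in> L2 \<Omega>"
  shows "(\<lambda>x. a *\<^sub>R u x + c *\<^sub>R v x) \<in> L2 \<Omega>"
proof -
  have eq: "(\<lambda>x. (norm (a *\<^sub>R u x + c *\<^sub>R v x))\<^sup>2) =
     (\<lambda>x. a\<^sup>2 * (u x \<bullet> u x) + 2 * a * c * (u x \<bullet> v x) + c\<^sup>2 * (v x \<bullet> v x))"
    unfolding power2_norm_eq_inner
    by (simp add: inner_add_left inner_add_right inner_commute[of "v _" "u _"]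
        power2_eq_square algebra_simps)
  have "integrable (lebesgue_on \<Omega>) (\<lambda>x. (norm (a *\<^sub>R u x + c *\<^sub>R v x))\<^sup>2)"
    unfolding eq using assms
    by (intro Bochner_Integration.integrable_add integrable_mult_right integrable_l2_inner)
  moreover have "(\<lambda>x. a *\<^sub>R u x + c *\<^sub>R v x) \<in> borel_measurable (lebesgue_on \<Omega>)"
    using assms[THEN l2_borel] by measurable
  ultimately show ?thesis
    by (simp add: L2_def)
qed

lemma l2_inner_commute: "l2_inner \<Omega> u v = l2_inner \<Omega> v u"
  by (simp add: l2_inner_def inner_commute)

lemma l2_inner_nonneg: "0 \<le> l2_inner \<Omega> u u"
  by (simp add: l2_inner_def)

lemma l2_norm_power2: "(l2_norm \<Omega> u)\<^sup>2 = l2_inner \<Omega> u u"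
  by (simp add: l2_norm_def l2_inner_nonneg)

lemma l2_norm_nonneg: "0 \<le> l2_norm \<Omega> u"
  by (simp add: l2_norm_def l2_inner_nonneg)

lemma l2_inner_sum_left:
  assumes "\<And>i. i \<in> I \<Longrightarrow> u i \<in> L2 \<Omega>" "v \<in> L2 \<Omega>"
  shows "l2_inner \<Omega> (\<lambda>x. \<Sum>i\<in>I. c i *\<^sub>R u i x) v = (\<Sum>i\<in>I. c i * l2_inner \<Omega> (u i) v)"
  using assms by (simp add: l2_inner_def inner_sum_left integrable_l2_inner)

lemma l2_inner_lincomb_left:
  assumes "u \<in> L2 \<Omega>" "v \<in> L2 \<Omega>" "w \<in> L2 \<Omega>"
  shows "l2_inner \<Omega> (\<lambda>x. a *\<^sub>R u x + c *\<^sub>R v x) w = a * l2_inner \<Omega> u w + c * l2_inner \<Omega> v w"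
  using assms by (simp add: l2_inner_def inner_add_left integrable_l2_inner)

lemma l2_inner_lincomb_right:
  assumes "u \<in> L2 \<Omega>" "v \<in> L2 \<Omega>" "w \<in> L2 \<Omega>"
  shows "l2_inner \<Omega> w (\<lambda>x. a *\<^sub>R u x + c *\<^sub>R v x) = a * l2_inner \<Omega> w u + c * l2_inner \<Omega> w v"
  using assms by (simp add: l2_inner_def inner_add_right integrable_l2_inner)

lemma l2_inner_lincomb_square:
  assumes "u \<in> L2 \<Omega>" "v \<in> L2 \<Omega>"
  shows "l2_inner \<Omega> (\<lambda>x. a *\<^sub>R u x + c *\<^sub>R v x) (\<lambda>x. a *\<^sub>R u x + c *\<^sub>R v x) =
    a\<^sup>2 * l2_inner \<Omega> u u + 2 * a * c * l2_inner \<Omega> u v + c\<^sup>2 * l2_inner \<Omega> v v"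
  using assms
  by (simp add: l2_inner_lincomb_left l2_inner_lincomb_right l2_lincomb l2_inner_commute[of _ v u]
      power2_eq_square algebra_simps)

lemma l2_Cauchy_Schwarz:
  assumes "u \<in> L2 \<Omega>" "v \<in> L2 \<Omega>"
  shows "l2_inner \<Omega> u v \<le> l2_norm \<Omega> u * l2_norm \<Omega> v"
proof -
  define A B C where "A = l2_inner \<Omega> u u" "B = l2_inner \<Omega> v v" "C = l2_inner \<Omega> u v"
  note defs = this
  have quad: "0 \<le> a\<^sup>2 * A + 2 * a * c * C + c\<^sup>2 * B" for a c
    using l2_inner_nonneg[of \<Omega> "\<lambda>x. a *\<^sub>R u x + c *\<^sub>R v x"] l2_inner_lincomb_square[OF assms, of a c]
    by (simp add: defs)
  have "C\<^sup>2 \<le> A * B"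
  proof (cases "B = 0")
    case True
    \<comment> \<open>The form is then affine in \<open>c\<close> for \<open>a = 1\<close>, so it can only be nonnegative if \<open>C = 0\<close>.\<close>
    have "C = 0"
    proof (rule ccontr)
      assume "C \<noteq> 0"
      then show False
        using quad[of 1 "- (A + 1) / (2 * C)"] True by (simp add: field_simps)
    qed
    then show ?thesis using True by simp
  next
    case False
    then have "0 < B"
      using l2_inner_nonneg[of \<Omega> v] by (simp add: defs)
    \<comment> \<open>The choice \<open>a = B\<close>, \<open>c = - C\<close> minimizes the form up to scaling.\<close>
    have "0 \<le> B * (A * B - C\<^sup>2)"
      using quad[of B "- C"] by (simp add: power2_eq_square algebra_simps)
    then show ?thesis
      using \<open>0 < B\<close> by (simp add: zero_le_mult_iff)
  qed
  then have "C\<^sup>2 \<le> (l2_norm \<Omega> u * l2_norm \<Omega> v)\<^sup>2"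
    by (simp add: power_mult_distrib l2_norm_power2 defs)
  then have "C \<le> l2_norm \<Omega> u * l2_norm \<Omega> v"
    by (rule power2_le_imp_le) (simp add: l2_norm_nonneg)
  then show ?thesis by (simp add: defs)
qed

lemma l2_norm_lincomb_le:
  assumes "u \<in> L2 \<Omega>" "v \<in> L2 \<Omega>" "0 \<le> a" "0 \<le> c"
  shows "l2_norm \<Omega> (\<lambda>x. a *\<^sub>R u x + c *\<^sub>R v x) \<le> a * l2_norm \<Omega> u + c * l2_norm \<Omega> v"
proof (rule power2_le_imp_le)
  have "a * c * l2_inner \<Omega> u v \<le> a * c * (l2_norm \<Omega> u * l2_norm \<Omega> v)"
    using assms by (intro mult_left_mono l2_Cauchy_Schwarz) auto
  then show "(l2_norm \<Omega> (\<lambda>x. a *\<^sub>R u x + c *\<^sub>R v x))\<^sup>2 \<le> (a * l2_norm \<Omega> u + c * l2_norm \<Omega> v)\<^sup>2"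
    using assms
    by (simp add: l2_norm_power2 l2_inner_lincomb_square power2_sum power_mult_distrib algebra_simps)
  show "0 \<le> a * l2_norm \<Omega> u + c * l2_norm \<Omega> v"
    using assms by (simp add: l2_norm_nonneg)
qed

lemma weighted_eq: "weighted \<theta> v n = (\<lambda>x. \<theta> *\<^sub>R v n x + (1 - \<theta>) *\<^sub>R v (n - 1) x)"
  by (simp add: weighted_def fun_eq_iff)

lemma l2_weighted:
  assumes "v n \<in> L2 \<Omega>" "v (n - 1) \<in> L2 \<Omega>"
  shows "weighted \<theta> v n \<in> L2 \<Omega>"
  unfolding weighted_eq using assms by (rule l2_lincomb)

lemma l2_norm_weighted_le:
  assumes "v n \<in> L2 \<Omega>" "v (n - 1) \<in> L2 \<Omega>" "0 \<le> \<theta>" "\<theta> \<le> 1"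
  shows "l2_norm \<Omega> (weighted \<theta> v n) \<le> \<theta> * l2_norm \<Omega> (v n) + (1 - \<theta>) * l2_norm \<Omega> (v (n - 1))"
  unfolding weighted_eq using assms by (intro l2_norm_lincomb_le) auto

section \<open>Discrete orthogonal convolution kernels\<close>

text \<open>The recursion of the DOC kernels is this orthogonality relation solved for its first term: the
  matrix with entries \<open>d\<^sub>n\<^sub>-\<^sub>j\<^sup>(\<^sup>n\<^sup>)\<close> is a left inverse of the lower triangular matrix of \<open>b\<close>.\<close>

lemma doc_kernel_orthogonal:
  assumes "1 \<le> k" "k \<le> n" "b k 0 \<noteq> 0"
  shows "(\<Sum>j=k..n. doc_kernel b n (n - j) * b j (j - k)) = (if k = n then 1 else 0)"
proof (cases "k = n")
  case True
  then show ?thesis using assms by (simp add: doc_kernel_0)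
next
  case False
  then have "(\<Sum>j=k..n. doc_kernel b n (n - j) * b j (j - k)) =
      doc_kernel b n (n - k) * b k 0 + (\<Sum>j=k+1..n. doc_kernel b n (n - j) * b j (j - k))"
    using assms by (simp add: sum.atLeast_Suc_atMost)
  also have "\<dots> = 0"
    using assms False doc_kernel_rec[of k n b] by simp
  finally show ?thesis using False by simp
qed

lemma doc_kernel_inverts:
  fixes w :: "nat \<Rightarrow> real"
  assumes "1 \<le> n" "\<And>k. k \<in> {1..n} \<Longrightarrow> b k 0 \<noteq> 0"
  shows "(\<Sum>j=1..n. doc_kernel b n (n - j) * (\<Sum>k=1..j. b j (j - k) * w k)) = w n"
proof -
  have "(\<Sum>j=1..n. doc_kernel b n (n - j) * (\<Sum>k=1..j. b j (j - k) * w k)) =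
      (\<Sum>j=1..n. \<Sum>k\<in>{k\<in>{1..n}. k \<le> j}. doc_kernel b n (n - j) * (b j (j - k) * w k))"
    unfolding sum_distrib_left by (intro sum.cong) auto
  also have "\<dots> = (\<Sum>k=1..n. \<Sum>j\<in>{j\<in>{1..n}. k \<le> j}. doc_kernel b n (n - j) * (b j (j - k) * w k))"
    by (rule sum.swap_restrict) auto
  also have "\<dots> = (\<Sum>k=1..n. w k * (\<Sum>j=k..n. doc_kernel b n (n - j) * b j (j - k)))"
    unfolding sum_distrib_left by (intro sum.cong) (auto simp: algebra_simps)
  also have "\<dots> = (\<Sum>k=1..n. w k * (if k = n then 1 else 0))"
    using assms(2) by (intro sum.cong refl) (subst doc_kernel_orthogonal; auto)
  also have "\<dots> = w n"
    using assms(1) by (simp add: if_distrib[of "\<lambda>x. _ * x"] cong: if_cong)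
  finally show ?thesis .
qed

text \<open>Forward substitution: a lower triangular system with nonzero diagonal is solvable. Existence is
  enough here, since the left inverse then identifies the solution as \<open>d\<close> applied to the data.\<close>

lemma convolution_solvable:
  fixes v :: "nat \<Rightarrow> real" and b :: "nat \<Rightarrow> nat \<Rightarrow> real"
  assumes "\<And>k. k \<in> {1..n} \<Longrightarrow> b k 0 \<noteq> 0"
  shows "\<exists>w. \<forall>k\<in>{1..n}. (\<Sum>j=1..k. b k (k - j) * w j) = v k"
  using assms
proof (induction n)
  case 0
  then show ?case by simp
next
  case (Suc n)
  then obtain w where w: "\<And>k. k \<in> {1..n} \<Longrightarrow> (\<Sum>j=1..k. b k (k - j) * w j) = v k"
    by fastforce
  define w' where
    "w' = w(Suc n := (v (Suc n) - (\<Sum>j=1..n. b (Suc n) (Suc n - j) * w j)) / b (Suc n) 0)"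
  have old: "(\<Sum>j=1..k. b i (i - j) * w' j) = (\<Sum>j=1..k. b i (i - j) * w j)" if "k \<le> n" for i k
    using that by (intro sum.cong) (auto simp: w'_def)
  have "(\<Sum>j=1..k. b k (k - j) * w' j) = v k" if "k \<in> {1..Suc n}" for k
  proof (cases "k = Suc n")
    case True
    then show ?thesis
      using old[of n "Suc n"] Suc.prems[of "Suc n"] by (simp add: w'_def)
  next
    case False
    then show ?thesis using that old[of k k] w[of k] by simp
  qed
  then show ?case by blast
qed

text \<open>If \<open>D B = I\<close> and \<open>v = B w\<close>, then \<open>v \<bullet> D v = B w \<bullet> w\<close>.\<close>

lemma doc_kernel_positive_semidefinite:
  assumes "positive_semidefinite_kernel N b" "\<And>k. k \<in> {1..N} \<Longrightarrow> b k 0 \<noteq> 0"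
  shows "positive_semidefinite_kernel N (doc_kernel b)"
  unfolding positive_semidefinite_kernel_def
proof (intro ballI allI)
  fix n and v :: "nat \<Rightarrow> real"
  assume n: "n \<in> {1..N}"
  obtain w where w: "\<And>k. k \<in> {1..n} \<Longrightarrow> (\<Sum>j=1..k. b k (k - j) * w j) = v k"
    using convolution_solvable[of n b v] assms(2) n by fastforce
  have dv: "(\<Sum>j=1..k. doc_kernel b k (k - j) * v j) = w k" if "k \<in> {1..n}" for k
  proof -
    have "(\<Sum>j=1..k. doc_kernel b k (k - j) * v j) =
        (\<Sum>j=1..k. doc_kernel b k (k - j) * (\<Sum>i=1..j. b j (j - i) * w i))"
      using that w by (intro sum.cong) auto
    also have "\<dots> = w k"
      using that n assms(2) by (intro doc_kernel_inverts) auto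
    finally show ?thesis .
  qed
  have "0 \<le> (\<Sum>k=1..n. w k * (\<Sum>j=1..k. b k (k - j) * w j))"
    using assms(1) n by (simp add: positive_semidefinite_kernel_def)
  also have "\<dots> = (\<Sum>k=1..n. v k * (\<Sum>j=1..k. doc_kernel b k (k - j) * v j))"
    using w dv by (intro sum.cong) auto
  finally show "0 \<le> (\<Sum>k=1..n. v k * (\<Sum>j=1..k. doc_kernel b k (k - j) * v j))" .
qed

text \<open>Matrices of this sign pattern (positive diagonal, nonpositive off-diagonal entries) are
  triangular M-matrices, whose inverses have nonnegative entries.\<close>

lemma doc_kernel_nonneg:
  assumes diag: "\<And>k. k \<in> {1..n} \<Longrightarrow> 0 < b k 0"
    and off: "\<And>k j. k \<in> {1..n} \<Longrightarrow> 0 < j \<Longrightarrow> b k j \<le> 0"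
  shows "m < n \<Longrightarrow> 0 \<le> doc_kernel b n m"
proof (induction m rule: less_induct)
  case (less m)
  show ?case
  proof (cases "m = 0")
    case True
    then show ?thesis using less.prems diag[of n] by (simp add: doc_kernel_0)
  next
    case False
    define k where "k = n - m"
    have k: "1 \<le> k" "k \<le> n - 1" "m = n - k"
      using less.prems False by (auto simp: k_def)
    have "(\<Sum>j=k+1..n. doc_kernel b n (n - j) * b j (j - k)) \<le> 0"
      using k less.prems by (intro sum_nonpos mult_nonneg_nonpos less.IH off) auto
    then show ?thesis
      using k diag[of k] doc_kernel_rec[OF k(1,2), of b] by (simp add: divide_nonpos_pos)
  qed
qed

text \<open>The scalar inequality applies pointwise to each coordinate of \<open>g\<close>; summing over the coordinates
  and integrating gives the claim.\<close>

lemma positive_semidefinite_kernel_l2: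
  assumes psd: "positive_semidefinite_kernel N b" and n: "n \<in> {1..N}"
    and g: "\<And>k. k \<in> {1..n} \<Longrightarrow> g k \<in> L2 \<Omega>"
  shows "0 \<le> (\<Sum>k=1..n. \<Sum>j=1..k. b k (k - j) * l2_inner \<Omega> (g j) (g k))"
proof -
  have "(\<Sum>k=1..n. \<Sum>j=1..k. b k (k - j) * l2_inner \<Omega> (g j) (g k)) =
      (\<integral>x. (\<Sum>k=1..n. \<Sum>j=1..k. b k (k - j) * (g j x \<bullet> g k x)) \<partial>lebesgue_on \<Omega>)"
  proof -
    have int: "integrable (lebesgue_on \<Omega>) (\<lambda>x. b k (k - j) * (g j x \<bullet> g k x))"
      if "k \<in> {1..n}" "j \<in> {1..k}" for k j
      using that by (intro integrable_mult_right integrable_l2_inner g) auto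
    have "(\<integral>x. (\<Sum>k=1..n. \<Sum>j=1..k. b k (k - j) * (g j x \<bullet> g k x)) \<partial>lebesgue_on \<Omega>) =
        (\<Sum>k=1..n. \<integral>x. (\<Sum>j=1..k. b k (k - j) * (g j x \<bullet> g k x)) \<partial>lebesgue_on \<Omega>)"
      by (intro Bochner_Integration.integral_sum Bochner_Integration.integrable_sum int)
    also have "\<dots> = (\<Sum>k=1..n. \<Sum>j=1..k. \<integral>x. b k (k - j) * (g j x \<bullet> g k x) \<partial>lebesgue_on \<Omega>)"
      by (intro sum.cong refl Bochner_Integration.integral_sum int)
    finally show ?thesis by (simp add: l2_inner_def)
  qed
  also have "0 \<le> \<dots>"
  proof (rule Bochner_Integration.integral_nonneg)
    fix x
    have "(\<Sum>k=1..n. \<Sum>j=1..k. b k (k - j) * (g j x \<bullet> g k x)) =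
        (\<Sum>k=1..n. \<Sum>j=1..k. \<Sum>e\<in>Basis. (g k x \<bullet> e) * (b k (k - j) * (g j x \<bullet> e)))"
      by (simp add: euclidean_inner[of "g _ x" "g _ x"] sum_distrib_left mult_ac)
    also have "\<dots> = (\<Sum>k=1..n. \<Sum>e\<in>Basis. \<Sum>j=1..k. (g k x \<bullet> e) * (b k (k - j) * (g j x \<bullet> e)))"
      by (intro sum.cong refl sum.swap)
    also have "\<dots> = (\<Sum>e\<in>Basis. \<Sum>k=1..n. (g k x \<bullet> e) * (\<Sum>j=1..k. b k (k - j) * (g j x \<bullet> e)))"
      unfolding sum_distrib_left by (rule sum.swap)
    also have "0 \<le> \<dots>"
      using psd n by (intro sum_nonneg[of Basis]) (simp add: positive_semidefinite_kernel_def)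
    finally show "0 \<le> (\<Sum>k=1..n. \<Sum>j=1..k. b k (k - j) * (g j x \<bullet> g k x))" .
  qed
  finally show ?thesis .
qed

section \<open>The kernels of the weighted and shifted BDF2 method\<close>

lemma step_pos: "time_grid t N \<Longrightarrow> k \<in> {1..N} \<Longrightarrow> 0 < step t k"
  by (auto simp: time_grid_def step_def)

lemma step_ratio_pos: "time_grid t N \<Longrightarrow> k \<in> {2..N} \<Longrightarrow> 0 < step_ratio t k"
  unfolding step_ratio_def by (intro divide_pos_pos step_pos) auto

lemma wsbdf2_kernel_diag_pos:
  assumes "time_grid t N" "0 \<le> \<theta>" "k \<in> {1..N}"
  shows "0 < wsbdf2_kernel \<theta> t k 0"
proof (cases "k = 1")
  case True
  then show ?thesis using step_pos[OF assms(1,3)] by (simp add: wsbdf2_kernel_def)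
next
  case False
  then have "0 < step_ratio t k" "0 < step t k"
    using assms by (auto intro: step_ratio_pos step_pos)
  then show ?thesis
    using assms False
    by (auto simp: wsbdf2_kernel_def intro!: divide_pos_pos mult_pos_pos add_pos_nonneg)
qed

lemma wsbdf2_kernel_offdiag_nonpos:
  assumes "time_grid t N" "1/2 \<le> \<theta>" "k \<in> {1..N}" "0 < j"
  shows "wsbdf2_kernel \<theta> t k j \<le> 0"
proof (cases "k = 1 \<or> j \<noteq> 1")
  case True
  then show ?thesis using assms by (auto simp: wsbdf2_kernel_def)
next
  case False
  then have "0 < step_ratio t k" "0 < step t k"
    using assms by (auto intro: step_ratio_pos step_pos)
  then show ?thesis
    using assms False
    by (auto simp: wsbdf2_kernel_def intro!: divide_nonpos_pos mult_pos_pos mult_nonpos_nonneg)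
qed

text \<open>This is first-order consistency: the difference operator applied to the function \<open>t\<close> is \<open>1\<close>.\<close>

lemma wsbdf2_kernel_step_sum:
  assumes "time_grid t N" "j \<in> {1..N}"
  shows "(\<Sum>k=1..j. wsbdf2_kernel \<theta> t j (j - k) * step t k) = 1"
proof (cases "j = 1")
  case True
  then show ?thesis using step_pos[OF assms] by (simp add: wsbdf2_kernel_def)
next
  case False
  have pos: "0 < step t j" "0 < step t (j - 1)"
    using assms(2) False by (auto intro!: step_pos[OF assms(1)])
  have "(\<Sum>k=1..j. wsbdf2_kernel \<theta> t j (j - k) * step t k) =
      (\<Sum>k\<in>{j-1,j}. wsbdf2_kernel \<theta> t j (j - k) * step t k)"
    using assms False by (intro sum.mono_neutral_right) (auto simp: wsbdf2_kernel_def)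
  also have "\<dots> = wsbdf2_kernel \<theta> t j 1 * step t (j - 1) + wsbdf2_kernel \<theta> t j 0 * step t j"
    using assms False by auto
  also have "\<dots> = 1"
  proof -
    define r s where "r = step_ratio t j" "s = step t (j - 1)"
    note rs = this
    have "0 < r" and s: "0 < s" and step: "step t j = r * s"
      using pos by (auto simp: rs step_ratio_def)
    then have "0 < r * s * (1 + r)" by simp
    then have "(1 - 2 * \<theta>) * r\<^sup>2 / (r * s * (1 + r)) * s
        + (1 + 2 * \<theta> * r) / (r * s * (1 + r)) * (r * s) = 1"
      unfolding times_divide_eq_left add_divide_distrib[symmetric]
      by (subst divide_eq_1_iff) (simp add: power2_eq_square algebra_simps)
    moreover have "wsbdf2_kernel \<theta> t j 1 = (1 - 2 * \<theta>) * r\<^sup>2 / (r * s * (1 + r))"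
      and "wsbdf2_kernel \<theta> t j 0 = (1 + 2 * \<theta> * r) / (r * s * (1 + r))"
      using False by (simp_all add: wsbdf2_kernel_def step rs(1)[symmetric])
    ultimately show ?thesis
      by (simp only: step rs(2)[symmetric])
  qed
  finally show ?thesis .
qed

text \<open>By consistency the constant sequence \<open>1\<close> is the convolution of \<open>b\<close> with the steps, and the DOC
  kernels recover the steps from it.\<close>

lemma wsbdf2_doc_kernel_row_sum:
  assumes "time_grid t N" "0 \<le> \<theta>" "k \<in> {1..N}"
  shows "(\<Sum>j=1..k. doc_kernel (wsbdf2_kernel \<theta> t) k (k - j)) = step t k"
proof -
  let ?b = "wsbdf2_kernel \<theta> t"
  have "(\<Sum>j=1..k. doc_kernel ?b k (k - j)) =
      (\<Sum>j=1..k. doc_kernel ?b k (k - j) * (\<Sum>i=1..j. ?b j (j - i) * step t i))"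
    using assms wsbdf2_kernel_step_sum[OF assms(1), of _ \<theta>] by (intro sum.cong) auto
  also have "\<dots> = step t k"
    using assms wsbdf2_kernel_diag_pos[OF assms(1,2)]
    by (intro doc_kernel_inverts) (auto simp: less_imp_neq[symmetric])
  finally show ?thesis .
qed

lemma sum_steps: "time_grid t N \<Longrightarrow> (\<Sum>k=1..n. step t k) = t n"
  by (induction n) (auto simp: step_def time_grid_def)

section \<open>Energy estimate and stability\<close>

text \<open>The difference of the two sides is \<open>(2 \<theta> - 1) \<parallel>v\<^sup>n - v\<^sup>n\<^sup>-\<^sup>1\<parallel>\<^sup>2\<close>.\<close>

lemma l2_inner_diff_weighted_ge:
  assumes "v n \<in> L2 \<Omega>" "v (n - 1) \<in> L2 \<Omega>" "1/2 \<le> \<theta>"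
  shows "(l2_norm \<Omega> (v n))\<^sup>2 - (l2_norm \<Omega> (v (n - 1)))\<^sup>2
    \<le> 2 * l2_inner \<Omega> (\<lambda>x. v n x - v (n - 1) x) (weighted \<theta> v n)"
proof -
  let ?a = "l2_inner \<Omega> (v n) (v n)" and ?c = "l2_inner \<Omega> (v n) (v (n - 1))"
    and ?e = "l2_inner \<Omega> (v (n - 1)) (v (n - 1))"
  have diff: "(\<lambda>x. v n x - v (n - 1) x) = (\<lambda>x. 1 *\<^sub>R v n x + (- 1) *\<^sub>R v (n - 1) x)"
    by simp
  have "0 \<le> ?a - 2 * ?c + ?e"
    using l2_inner_nonneg[of \<Omega> "\<lambda>x. v n x - v (n - 1) x"]
      l2_inner_lincomb_square[OF assms(1,2), of 1 "-1"] by simp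
  then have "0 \<le> (2 * \<theta> - 1) * (?a - 2 * ?c + ?e)"
    using assms(3) by simp
  moreover have "l2_inner \<Omega> (\<lambda>x. v n x - v (n - 1) x) (weighted \<theta> v n) =
      \<theta> * ?a + (1 - \<theta>) * ?c - \<theta> * ?c - (1 - \<theta>) * ?e"
    unfolding diff weighted_eq
    using assms
    by (simp only: l2_inner_lincomb_left l2_inner_lincomb_right l2_lincomb
        l2_inner_commute[of \<Omega> "v (n - 1)" "v n"]) (simp add: algebra_simps)
  ultimately show ?thesis
    unfolding l2_norm_power2 by (simp add: algebra_simps)
qed

text \<open>Convolving the tested scheme with the DOC kernels leaves a telescoping difference of squares, a
  gradient term of favourable sign that is dropped, and the source term on the right.\<close>

lemma wsbdf2_energy:
  assumes \<theta>: "\<theta> \<in> {1/2..1}"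
    and grid: "time_grid t N"
    and fL2: "\<forall>j\<in>{0..N}. f (t j) \<in> L2 \<Omega>"
    and sol: "wsbdf2_solution \<Omega> \<theta> t N f u"
    and psd: "positive_semidefinite_kernel N (wsbdf2_kernel \<theta> t)"
    and n: "n \<in> {1..N}"
  shows "(l2_norm \<Omega> (u n))\<^sup>2 \<le> (l2_norm \<Omega> (u 0))\<^sup>2 + 2 * (\<Sum>k=1..n. \<Sum>j=1..k.
    doc_kernel (wsbdf2_kernel \<theta> t) k (k - j) *
    l2_inner \<Omega> (weighted \<theta> (\<lambda>i. f (t i)) j) (weighted \<theta> u k))"
proof -
  let ?b = "wsbdf2_kernel \<theta> t"
  let ?d = "doc_kernel ?b"
  let ?F = "\<lambda>j. weighted \<theta> (\<lambda>i. f (t i)) j"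
  obtain Du where Du: "\<And>k. k \<le> N \<Longrightarrow> H01_gradient \<Omega> (u k) (Du k)"
    and scheme: "\<And>j \<phi> D\<phi>. j \<in> {1..N} \<Longrightarrow> H01_gradient \<Omega> \<phi> D\<phi> \<Longrightarrow>
      l2_inner \<Omega> (wsbdf2_op \<theta> t u j) \<phi> + l2_inner \<Omega> (weighted \<theta> Du j) D\<phi> =
      l2_inner \<Omega> (?F j) \<phi>"
    using sol unfolding wsbdf2_solution_def by fastforce
  have uL2: "u k \<in> L2 \<Omega>" and DuL2: "Du k \<in> L2 \<Omega>" if "k \<le> N" for k
    using Du[OF that] by (auto simp: H01_gradient_def H1_gradient_def)
  have diffL2: "(\<lambda>x. u k x - u (k - 1) x) \<in> L2 \<Omega>" if "k \<le> N" for k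
    using l2_lincomb[OF uL2[of k] uL2[of "k - 1"], of 1 "-1"] that by simp
  have wuL2: "weighted \<theta> u k \<in> L2 \<Omega>" and wDuL2: "weighted \<theta> Du k \<in> L2 \<Omega>"
    and FL2: "?F k \<in> L2 \<Omega>" if "k \<le> N" for k
    using that uL2 DuL2 fL2 by (auto intro!: l2_weighted)
  have op_inner: "l2_inner \<Omega> (wsbdf2_op \<theta> t u j) v =
      (\<Sum>i=1..j. ?b j (j - i) * l2_inner \<Omega> (\<lambda>x. u i x - u (i - 1) x) v)"
    if "j \<le> N" "v \<in> L2 \<Omega>" for j v
  proof -
    have "wsbdf2_op \<theta> t u j = (\<lambda>x. \<Sum>i=1..j. ?b j (j - i) *\<^sub>R (u i x - u (i - 1) x))"
      by (simp add: wsbdf2_op_def fun_eq_iff)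
    then show ?thesis
      using that diffL2 by (simp only:) (rule l2_inner_sum_left; auto)
  qed
  \<comment> \<open>Testing with \<open>u k\<close> and \<open>u (k - 1)\<close> separately and combining the two equations avoids showing
    that \<open>H\<^sub>0\<^sup>1\<close> is a linear space.\<close>
  have tested: "(\<Sum>i=1..j. ?b j (j - i) * l2_inner \<Omega> (\<lambda>x. u i x - u (i - 1) x) (weighted \<theta> u k)) +
      l2_inner \<Omega> (weighted \<theta> Du j) (weighted \<theta> Du k) = l2_inner \<Omega> (?F j) (weighted \<theta> u k)"
    if j: "j \<in> {1..N}" and k: "k \<le> N" for j k
  proof -
    have right: "l2_inner \<Omega> g (weighted \<theta> v k) =
        \<theta> * l2_inner \<Omega> g (v k) + (1 - \<theta>) * l2_inner \<Omega> g (v (k - 1))"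
      if "g \<in> L2 \<Omega>" "v k \<in> L2 \<Omega>" "v (k - 1) \<in> L2 \<Omega>" for g :: "'a \<Rightarrow> 'c::euclidean_space" and v
      unfolding weighted_eq using that by (intro l2_inner_lincomb_right) auto
    have km: "k - 1 \<le> N" and jN: "j \<le> N" using j k by auto
    have "(\<Sum>i=1..j. ?b j (j - i) * l2_inner \<Omega> (\<lambda>x. u i x - u (i - 1) x) (weighted \<theta> u k)) =
       \<theta> * l2_inner \<Omega> (wsbdf2_op \<theta> t u j) (u k)
       + (1 - \<theta>) * l2_inner \<Omega> (wsbdf2_op \<theta> t u j) (u (k - 1))"
      using jN diffL2 uL2[OF k] uL2[OF km]
      by (simp add: op_inner right sum_distrib_left sum.distrib[symmetric] distrib_left mult_ac)
    then show ?thesis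
      using right[of "weighted \<theta> Du j" Du, OF wDuL2[OF jN] DuL2[OF k] DuL2[OF km]]
        right[of "?F j" u, OF FL2[OF jN] uL2[OF k] uL2[OF km]]
        scheme[OF j Du[OF k], THEN arg_cong[where f = "(*) \<theta>"]]
        scheme[OF j Du[OF km], THEN arg_cong[where f = "(*) (1 - \<theta>)"]]
      by (simp only: distrib_left)
  qed
  have convolved: "l2_inner \<Omega> (\<lambda>x. u k x - u (k - 1) x) (weighted \<theta> u k) +
      (\<Sum>j=1..k. ?d k (k - j) * l2_inner \<Omega> (weighted \<theta> Du j) (weighted \<theta> Du k)) =
      (\<Sum>j=1..k. ?d k (k - j) * l2_inner \<Omega> (?F j) (weighted \<theta> u k))"
    if k: "k \<in> {1..N}" for k
  proof -
    have "(\<Sum>j=1..k. ?d k (k - j) *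
        (\<Sum>i=1..j. ?b j (j - i) * l2_inner \<Omega> (\<lambda>x. u i x - u (i - 1) x) (weighted \<theta> u k))) =
        l2_inner \<Omega> (\<lambda>x. u k x - u (k - 1) x) (weighted \<theta> u k)"
      using k \<theta> wsbdf2_kernel_diag_pos[OF grid, of \<theta>]
      by (intro doc_kernel_inverts[of k ?b "\<lambda>i. l2_inner \<Omega> (\<lambda>x. u i x - u (i - 1) x) (weighted \<theta> u k)"])
        (auto simp: less_imp_neq[symmetric])
    moreover have "(\<Sum>j=1..k. ?d k (k - j) * l2_inner \<Omega> (?F j) (weighted \<theta> u k)) =
      (\<Sum>j=1..k. ?d k (k - j) *
        ((\<Sum>i=1..j. ?b j (j - i) * l2_inner \<Omega> (\<lambda>x. u i x - u (i - 1) x) (weighted \<theta> u k)) +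
        l2_inner \<Omega> (weighted \<theta> Du j) (weighted \<theta> Du k)))"
      using k by (intro sum.cong refl) (subst tested; auto)
    ultimately show ?thesis
      by (simp only: distrib_left sum.distrib)
  qed
  have "0 \<le> (\<Sum>k=1..n. \<Sum>j=1..k. ?d k (k - j) * l2_inner \<Omega> (weighted \<theta> Du j) (weighted \<theta> Du k))"
    using n \<theta> wDuL2 wsbdf2_kernel_diag_pos[OF grid, of \<theta>]
    by (intro positive_semidefinite_kernel_l2[OF doc_kernel_positive_semidefinite[OF psd]])
      (auto simp: less_imp_neq[symmetric])
  also have "\<dots> = (\<Sum>k=1..n. (\<Sum>j=1..k. ?d k (k - j) * l2_inner \<Omega> (?F j) (weighted \<theta> u k))
      - l2_inner \<Omega> (\<lambda>x. u k x - u (k - 1) x) (weighted \<theta> u k))"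
    using n convolved by (intro sum.cong refl) (simp add: eq_diff_eq add.commute)
  finally have "(\<Sum>k=1..n. l2_inner \<Omega> (\<lambda>x. u k x - u (k - 1) x) (weighted \<theta> u k))
      \<le> (\<Sum>k=1..n. \<Sum>j=1..k. ?d k (k - j) * l2_inner \<Omega> (?F j) (weighted \<theta> u k))"
    by (simp add: sum_subtractf)
  moreover have "(l2_norm \<Omega> (u n))\<^sup>2 - (l2_norm \<Omega> (u 0))\<^sup>2 =
      (\<Sum>k=1..n. (l2_norm \<Omega> (u k))\<^sup>2 - (l2_norm \<Omega> (u (k - 1)))\<^sup>2)"
    using sum_telescope''[of 0 n "\<lambda>k. (l2_norm \<Omega> (u k))\<^sup>2"]
    by (simp add: sum.atLeast_Suc_atMost_Suc_shift atLeastSucAtMost_greaterThanAtMost)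
  moreover have "\<dots> \<le> (\<Sum>k=1..n. 2 * l2_inner \<Omega> (\<lambda>x. u k x - u (k - 1) x) (weighted \<theta> u k))"
    using n \<theta> uL2 by (intro sum_mono l2_inner_diff_weighted_ge) auto
  ultimately show ?thesis
    by (simp add: sum_distrib_left[symmetric])
qed

text \<open>Dividing the energy inequality by \<open>\<parallel>u\<^sup>n\<parallel>\<close> directly would leave earlier norms on the right-hand side,
  so it is used at the time level where the norm is maximal; the bound there is inherited by \<open>n\<close>.\<close>

lemma wsbdf2_stability:
  assumes \<theta>: "\<theta> \<in> {1/2..1}"
    and grid: "time_grid t N"
    and fL2: "\<forall>j\<in>{0..N}. f (t j) \<in> L2 \<Omega>"
    and sol: "wsbdf2_solution \<Omega> \<theta> t N f u"
    and psd: "positive_semidefinite_kernel N (wsbdf2_kernel \<theta> t)"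
    and n: "n \<in> {1..N}"
  shows "l2_norm \<Omega> (u n) \<le> l2_norm \<Omega> (u 0) + 2 * (\<Sum>k=1..n. \<Sum>j=1..k.
    doc_kernel (wsbdf2_kernel \<theta> t) k (k - j) * l2_norm \<Omega> (weighted \<theta> (\<lambda>i. f (t i)) j))"
proof -
  let ?d = "doc_kernel (wsbdf2_kernel \<theta> t)"
  let ?F = "\<lambda>j. weighted \<theta> (\<lambda>i. f (t i)) j"
  define R where "R m = (\<Sum>k=1..m. \<Sum>j=1..k. ?d k (k - j) * l2_norm \<Omega> (?F j))" for m
  have uL2: "u k \<in> L2 \<Omega>" if "k \<le> N" for k
    using sol that by (auto simp: wsbdf2_solution_def H01_gradient_def H1_gradient_def)
  have wuL2: "weighted \<theta> u k \<in> L2 \<Omega>" and FL2: "?F k \<in> L2 \<Omega>" if "k \<le> N" for k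
    using that uL2 fL2 by (auto intro!: l2_weighted)
  have d: "0 \<le> ?d k (k - j)" if "j \<in> {1..k}" "k \<le> N" for j k
    using that \<theta> by (intro doc_kernel_nonneg wsbdf2_kernel_diag_pos[OF grid]
        wsbdf2_kernel_offdiag_nonpos[OF grid]) auto
  have term_nonneg: "0 \<le> (\<Sum>j=1..k. ?d k (k - j) * l2_norm \<Omega> (?F j))" if "k \<le> N" for k
    using that d by (intro sum_nonneg mult_nonneg_nonneg l2_norm_nonneg) auto
  have "Max ((\<lambda>k. l2_norm \<Omega> (u k)) ` {0..n}) \<in> (\<lambda>k. l2_norm \<Omega> (u k)) ` {0..n}"
    by (rule Max_in) auto
  then obtain m where m: "m \<le> n" "l2_norm \<Omega> (u m) = Max ((\<lambda>k. l2_norm \<Omega> (u k)) ` {0..n})"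
    by (metis (no_types, lifting) imageE atLeastAtMost_iff)
  then have max: "l2_norm \<Omega> (u k) \<le> l2_norm \<Omega> (u m)" if "k \<le> n" for k
    using that by auto
  have Rn: "R m \<le> R n"
    unfolding R_def using m(1) n term_nonneg by (intro sum_mono2) auto
  have "l2_norm \<Omega> (u m) \<le> l2_norm \<Omega> (u 0) + 2 * R m"
  proof (cases "m = 0 \<or> l2_norm \<Omega> (u m) = 0")
    case True
    moreover have "0 \<le> R m"
      unfolding R_def using m(1) n term_nonneg by (intro sum_nonneg[of "{1..m}"]) auto
    ultimately show ?thesis
      using l2_norm_nonneg[of \<Omega> "u 0"] by auto
  next
    case False
    then have pos: "0 < l2_norm \<Omega> (u m)" and mN: "m \<in> {1..N}"
      using l2_norm_nonneg[of \<Omega> "u m"] m(1) n by auto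
    have weight: "l2_norm \<Omega> (weighted \<theta> u k) \<le> l2_norm \<Omega> (u m)" if "k \<le> m" for k
    proof -
      have "l2_norm \<Omega> (weighted \<theta> u k) \<le> \<theta> * l2_norm \<Omega> (u k) + (1 - \<theta>) * l2_norm \<Omega> (u (k - 1))"
        using that m(1) n \<theta> uL2 by (intro l2_norm_weighted_le) auto
      also have "\<dots> \<le> \<theta> * l2_norm \<Omega> (u m) + (1 - \<theta>) * l2_norm \<Omega> (u m)"
        using that m(1) \<theta> max by (intro add_mono mult_left_mono) auto
      finally show ?thesis by (simp add: algebra_simps)
    qed
    have "(\<Sum>k=1..m. \<Sum>j=1..k. ?d k (k - j) * l2_inner \<Omega> (?F j) (weighted \<theta> u k))
        \<le> (\<Sum>k=1..m. \<Sum>j=1..k. ?d k (k - j) * (l2_norm \<Omega> (?F j) * l2_norm \<Omega> (u m)))"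
    proof (intro sum_mono mult_left_mono)
      fix k j assume kj: "k \<in> {1..m}" "j \<in> {1..k}"
      then have "l2_inner \<Omega> (?F j) (weighted \<theta> u k) \<le> l2_norm \<Omega> (?F j) * l2_norm \<Omega> (weighted \<theta> u k)"
        using mN by (intro l2_Cauchy_Schwarz FL2 wuL2) auto
      also have "\<dots> \<le> l2_norm \<Omega> (?F j) * l2_norm \<Omega> (u m)"
        using kj by (intro mult_left_mono weight l2_norm_nonneg) auto
      finally show "l2_inner \<Omega> (?F j) (weighted \<theta> u k) \<le> l2_norm \<Omega> (?F j) * l2_norm \<Omega> (u m)" .
      show "0 \<le> ?d k (k - j)"
        using kj mN by (intro d) auto
    qed
    also have "\<dots> = R m * l2_norm \<Omega> (u m)"
      by (simp add: R_def sum_distrib_right mult.assoc)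
    finally have "(l2_norm \<Omega> (u m))\<^sup>2 \<le> (l2_norm \<Omega> (u 0))\<^sup>2 + 2 * (R m * l2_norm \<Omega> (u m))"
      using wsbdf2_energy[OF \<theta> grid fL2 sol psd mN] by simp
    also have "\<dots> \<le> l2_norm \<Omega> (u 0) * l2_norm \<Omega> (u m) + 2 * (R m * l2_norm \<Omega> (u m))"
      using max[of 0] by (simp add: power2_eq_square mult_left_mono l2_norm_nonneg)
    finally have "l2_norm \<Omega> (u m) * l2_norm \<Omega> (u m)
        \<le> (l2_norm \<Omega> (u 0) + 2 * R m) * l2_norm \<Omega> (u m)"
      by (simp add: power2_eq_square algebra_simps)
    then show ?thesis using pos by simp
  qed
  then show ?thesis
    using max[of n] Rn unfolding R_def by linarith
qed

text \<open>Row \<open>k\<close> of the nonnegative DOC kernels is a quadrature rule with total weight \<open>\<tau>\<^sub>k\<close>, and the steps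
  telescope to \<open>t\<^sub>n\<close>.\<close>

lemma wsbdf2_source_bound:
  assumes \<theta>: "\<theta> \<in> {1/2..1}" and grid: "time_grid t N" and n: "n \<in> {1..N}"
    and bound: "\<And>j. j \<in> {1..n} \<Longrightarrow> c j \<le> M"
  shows "(\<Sum>k=1..n. \<Sum>j=1..k. doc_kernel (wsbdf2_kernel \<theta> t) k (k - j) * c j) \<le> t n * M"
proof -
  let ?d = "doc_kernel (wsbdf2_kernel \<theta> t)"
  have "(\<Sum>k=1..n. \<Sum>j=1..k. ?d k (k - j) * c j) \<le> (\<Sum>k=1..n. \<Sum>j=1..k. ?d k (k - j) * M)"
  proof (intro sum_mono mult_left_mono)
    fix k j assume "k \<in> {1..n}" "j \<in> {1..k}"
    then show "c j \<le> M" "0 \<le> ?d k (k - j)"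
      using \<theta> n by (auto intro!: bound doc_kernel_nonneg wsbdf2_kernel_diag_pos[OF grid]
          wsbdf2_kernel_offdiag_nonpos[OF grid])
  qed
  also have "\<dots> = (\<Sum>k=1..n. step t k * M)"
    using \<theta> n wsbdf2_doc_kernel_row_sum[OF grid, of \<theta>]
    by (intro sum.cong) (auto simp: sum_distrib_right[symmetric])
  also have "\<dots> = t n * M"
    using sum_steps[OF grid, of n] by (simp add: sum_distrib_right[symmetric])
  finally show ?thesis .
qed

theorem theorem3p2:
  fixes \<Omega> :: "'a::euclidean_space set"
    and \<theta> :: real
    and t :: "nat \<Rightarrow> real"
    and N n :: nat
    and f :: "real \<Rightarrow> 'a \<Rightarrow> real"
    and u :: "nat \<Rightarrow> 'a \<Rightarrow> real"
  assumes "\<theta> \<in> {1/2..1}"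
    and "poincare_domain \<Omega>"
    and "time_grid t N"
    and "\<forall>j\<in>{0..N}. f (t j) \<in> L2 \<Omega>"
    and "wsbdf2_solution \<Omega> \<theta> t N f u"
    and "positive_semidefinite_kernel N (wsbdf2_kernel \<theta> t)"
    and "n \<in> {1..N}"
  shows "let
      S = l2_norm \<Omega> (u 0) + 2 * (\<Sum>k=1..n. \<Sum>j=1..k.
        doc_kernel (wsbdf2_kernel \<theta> t) k (k - j) * l2_norm \<Omega> (weighted \<theta> (\<lambda>i. f (t i)) j))
    in
      l2_norm \<Omega> (u n) \<le> S \<and>
      S \<le> l2_norm \<Omega> (u 0) + 2 * t n * (MAX j\<in>{0..n}. l2_norm \<Omega> (f (t j))) \<and>
      (\<theta> = 1 \<or> l2_norm \<Omega> (f (t 0)) \<le> (MAX j\<in>{1..n}. l2_norm \<Omega> (f (t j))) \<longrightarrow>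
       S \<le> l2_norm \<Omega> (u 0) + 2 * t n * (MAX j\<in>{1..n}. l2_norm \<Omega> (f (t j))))"
proof -
  have weight: "l2_norm \<Omega> (weighted \<theta> (\<lambda>i. f (t i)) j) \<le> M"
    if "j \<in> {1..n}" "l2_norm \<Omega> (f (t j)) \<le> M" "\<theta> = 1 \<or> l2_norm \<Omega> (f (t (j - 1))) \<le> M" for j M
  proof -
    have "l2_norm \<Omega> (weighted \<theta> (\<lambda>i. f (t i)) j)
        \<le> \<theta> * l2_norm \<Omega> (f (t j)) + (1 - \<theta>) * l2_norm \<Omega> (f (t (j - 1)))"
      using that assms by (intro l2_norm_weighted_le) auto
    also have "\<dots> \<le> \<theta> * M + (1 - \<theta>) * M"
      using that assms(1) by (intro add_mono) (auto intro: mult_left_mono)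
    finally show ?thesis by (simp add: algebra_simps)
  qed
  let ?R = "\<Sum>k=1..n. \<Sum>j=1..k.
    doc_kernel (wsbdf2_kernel \<theta> t) k (k - j) * l2_norm \<Omega> (weighted \<theta> (\<lambda>i. f (t i)) j)"
  have "?R \<le> t n * (MAX j\<in>{0..n}. l2_norm \<Omega> (f (t j)))"
    by (intro wsbdf2_source_bound[OF assms(1,3,7)] weight) auto
  moreover have "?R \<le> t n * (MAX j\<in>{1..n}. l2_norm \<Omega> (f (t j)))"
    if "\<theta> = 1 \<or> l2_norm \<Omega> (f (t 0)) \<le> (MAX j\<in>{1..n}. l2_norm \<Omega> (f (t j)))"
  proof (intro wsbdf2_source_bound[OF assms(1,3,7)] weight)
    fix j assume j: "j \<in> {1..n}"
    then show "l2_norm \<Omega> (f (t j)) \<le> (MAX j\<in>{1..n}. l2_norm \<Omega> (f (t j)))"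
      by auto
    \<comment> \<open>Only \<open>j = 1\<close> reaches the initial source value, which lies outside the maximum.\<close>
    show "\<theta> = 1 \<or> l2_norm \<Omega> (f (t (j - 1))) \<le> (MAX j\<in>{1..n}. l2_norm \<Omega> (f (t j)))"
    proof (cases "j = 1")
      case False
      then have "j - 1 \<in> {1..n}" using j by auto
      then show ?thesis by (intro disjI2 Max_ge) auto
    qed (use that in simp)
  qed
  ultimately show ?thesis
    using wsbdf2_stability[OF assms(1,3,4,5,6,7)] unfolding Let_def by auto
qed

end
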